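(* Consider three particles of mass $1$ in $\mathbb{R}^2$ moving according to $\ddot q_i=\partial U/\partial q_i$, $i=1,2,3$, with the Schwarzschild potential $U(q_1,q_2,q_3)=\sum_{1\le i<j\le 3}\left(\frac{1}{\|q_i-q_j\|}+\frac{1}{\|q_i-q_j\|^3}\right)$. Let $z_0=(1,0,-\tfrac12,\tfrac{\sqrt3}{2},-\tfrac12,-\tfrac{\sqrt3}{2})^T\in\mathbb{R}^6$ be the vertices of the equilateral triangle inscribed in the unit circle, and let $\omega>0$ be the angular velocity for which the uniform rotation of $z_0$ about the origin is a solution, namely $\omega^2=\frac{2}{\sqrt3}$. Then the corresponding relative equilibrium is (linearly) unstable: the linearized system at it has an eigenvalue with positive real part.
   Context: A configuration $z=(a_1,\dots,a_n)\in(\mathbb{R}^2)^n$ together with $\omega>0$ defines a relative equilibrium if $q_i(t)=\exp(-\omega Jt)a_i$, where $J=\begin{pmatrix}0&1\\-1&0\end{pmatrix}$ and hence $\exp(-\omega Jt)=\begin{pmatrix}\cos\omega t&-\sin\omega t\\ \sin\omega t&\cos\omega t\end{pmatrix}$, solves the equations of motion. In the rotating coordinates $q_i=\exp(-\omega Jt)x_i$ the equations become $\ddot x_i=2\omega J\dot x_i+\omega^2x_i+\nabla_{x_i}U$ (unit masses), and the relative equilibrium becomes the equilibrium $x=z$. The linearized system at it is $\ddot X=2\omega\mathbf{J}\dot X+\omega^2X+D^2U(z)X$ for $X\in\mathbb{R}^{2n}$, where $\mathbf{J}=\mathrm{diag}(J,\dots,J)$ ($n$ blocks) and $D^2U(z)$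 is the Hessian of $U$ at $z$. Its eigenvalues are those of the $4n\times4n$ matrix $\begin{pmatrix}0&I_{2n}\\ \omega^2I_{2n}+D^2U(z)&2\omega\mathbf{J}\end{pmatrix}$. The relative equilibrium is called (linearly) unstable if this matrix has an eigenvalue with positive real part. *)

theory Defs
  imports "HOL-Analysis.Analysis"
begin

(* The configuration space (R^2)^n is identified with R^(2n), whose coordinates are indexed by
   pairs (particle, Cartesian component). *)
type_synonym 'n config = "real ^ ('n \<times> 2)"

definition particle :: "'n::finite config \<Rightarrow> 'n \<Rightarrow> real ^ 2"
  where "particle z i = (\<chi> k. z $ (i, k))"

definition config_of :: "('n::finite \<Rightarrow> real ^ 2) \<Rightarrow> 'n config"
  where "config_of a = (\<chi> p. a (fst p) $ snd p)"

(* Meaningful only where f is differentiable; then GDERIV f x :> gradient f x. *)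
definition gradient :: "(real ^ 'm::finite \<Rightarrow> real) \<Rightarrow> real ^ 'm \<Rightarrow> real ^ 'm"
  where "gradient f x = (\<chi> a. frechet_derivative f (at x) (axis a 1))"

(* Meaningful only where f is twice differentiable. *)
definition hessian :: "(real ^ 'm::finite \<Rightarrow> real) \<Rightarrow> real ^ 'm \<Rightarrow> real ^ 'm ^ 'm"
  where "hessian f x = jacobian (gradient f) (at x)"

(* Newton's equations for unit masses, with no minus sign: U is the force function. The
   conjunct GDERIV also demands that U is differentiable along the trajectory. *)
definition solves_newton :: "('n::finite config \<Rightarrow> real) \<Rightarrow> (real \<Rightarrow> 'n config) \<Rightarrow> bool"
  where "solves_newton U q \<longleftrightarrow>
    (\<exists>v a. \<forall>t. (q has_vector_derivative v t) (at t)
             \<and> (v has_vector_derivative a t) (at t)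
             \<and> GDERIV U (q t) :> a t)"

definition J :: "real ^ 2 ^ 2"
  where "J = vector [vector [0, 1], vector [-1, 0]]"

(* exp(- s J) *)
definition rotation_matrix :: "real \<Rightarrow> real ^ 2 ^ 2"
  where "rotation_matrix s = vector [vector [cos s, - sin s], vector [sin s, cos s]]"

definition rotating :: "'n::finite config \<Rightarrow> real \<Rightarrow> real \<Rightarrow> 'n config"
  where "rotating z \<omega> t = config_of (\<lambda>i. rotation_matrix (\<omega> * t) *v particle z i)"

definition relative_equilibrium :: "('n::finite config \<Rightarrow> real) \<Rightarrow> 'n config \<Rightarrow> real \<Rightarrow> bool"
  where "relative_equilibrium U z \<omega> \<longleftrightarrow> \<omega> > 0 \<and> solves_newton U (rotating z \<omega>)"

(* diag(J, ..., J) *)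
definition block_J :: "real ^ ('n::finite \<times> 2) ^ ('n \<times> 2)"
  where "block_J = (\<chi> p r. if fst p = fst r then J $ snd p $ snd r else 0)"

definition block_matrix ::
  "'a ^ 'm::finite ^ 'm \<Rightarrow> 'a ^ 'm ^ 'm \<Rightarrow> 'a ^ 'm ^ 'm \<Rightarrow> 'a ^ 'm ^ 'm \<Rightarrow> 'a ^ ('m + 'm) ^ ('m + 'm)"
  where "block_matrix A B C D = (\<chi> r c.
    case r of
      Inl i \<Rightarrow> (case c of Inl j \<Rightarrow> A $ i $ j | Inr j \<Rightarrow> B $ i $ j)
    | Inr i \<Rightarrow> (case c of Inl j \<Rightarrow> C $ i $ j | Inr j \<Rightarrow> D $ i $ j))"

definition linearization ::
  "('n::finite config \<Rightarrow> real) \<Rightarrow> 'n config \<Rightarrow> real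
     \<Rightarrow> real ^ (('n \<times> 2) + ('n \<times> 2)) ^ (('n \<times> 2) + ('n \<times> 2))"
  where "linearization U z \<omega> =
    block_matrix 0 (mat 1) (\<omega>\<^sup>2 *\<^sub>R mat 1 + hessian U z) ((2 * \<omega>) *\<^sub>R block_J)"

definition complex_eigenvalue :: "real ^ 'm::finite ^ 'm \<Rightarrow> complex \<Rightarrow> bool"
  where "complex_eigenvalue A \<mu> \<longleftrightarrow>
    (\<exists>v. v \<noteq> 0 \<and> map_matrix complex_of_real A *v v = \<mu> *s v)"

definition linearly_unstable :: "('n::finite config \<Rightarrow> real) \<Rightarrow> 'n config \<Rightarrow> real \<Rightarrow> bool"
  where "linearly_unstable U z \<omega> \<longleftrightarrow>
    (\<exists>\<mu>. complex_eigenvalue (linearization U z \<omega>) \<mu> \<and> Re \<mu> > 0)"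

definition schwarzschild :: "'n::{finite,linorder} config \<Rightarrow> real"
  where "schwarzschild q =
    (\<Sum>(i, j) \<in> {(i, j). i < j}.
        1 / norm (particle q i - particle q j) + 1 / norm (particle q i - particle q j) ^ 3)"

(* Labels of type 3 are 1, 2, 3, where 3 = 0 comes first in the library's order; this is harmless,
   as each unordered pair still occurs exactly once in schwarzschild. *)
definition equilateral_triangle :: "3 config"
  where "equilateral_triangle = config_of (($) (vector
    [vector [1, 0], vector [-1/2, sqrt 3 / 2], vector [-1/2, - sqrt 3 / 2]] :: real ^ 2 ^ 3))"

end

theory Submission
  imports Defs
begin

text \<open>Identify the plane with the complex numbers, put the triangle at \<open>\<zeta>\<^sup>j\<close>
  with \<open>\<zeta>\<close> a primitive cube root of unity, and let the perturbation be
  \<open>X\<^sub>j = \<alpha> \<zeta>\<^sup>-\<^sup>j\<close>. On such perturbations the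
  Hessian acts as multiplication by \<open>\<omega>\<^sup>2\<close>, and \<open>J\<close> as
  multiplication by \<open>-\<i>\<close>. The linearized system therefore reduces to
  \<open>\<lambda>\<^sup>2 + 2 \<i> \<omega> \<lambda> - 2 \<omega>\<^sup>2 = 0\<close>, whose
  root \<open>\<lambda> = \<omega> (1 - \<i>)\<close> has positive real part.\<close>

section \<open>Coordinates of configurations\<close>

lemma particle_config_of [simp]: "particle (config_of a) i = a i"
  by (simp add: particle_def config_of_def vec_eq_iff)

lemma bounded_linear_particle: "bounded_linear (\<lambda>z. particle z i)"
  by (rule linear_conv_bounded_linear[THEN iffD1], rule linearI)
    (simp_all add: particle_def vec_eq_iff)

lemma inner_config_of: "config_of a \<bullet> h = (\<Sum>i\<in>UNIV. a i \<bullet> particle h i)"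
  by (simp add: inner_vec_def config_of_def particle_def sum.cartesian_product split_beta
      flip: UNIV_Times_UNIV)

section \<open>The pair potential and its first two derivatives\<close>

text \<open>The gradient at \<open>d\<close> of the pair potential
  \<open>1 / norm d + 1 / norm d ^ 3\<close>. With \<open>1 / 0 = 0\<close>, it takes the value 0 at
  the collision \<open>d = 0\<close>.\<close>

definition pair_force :: "'a::real_inner \<Rightarrow> 'a"
  where "pair_force d = - (1 / norm d ^ 3 + 3 / norm d ^ 5) *\<^sub>R d"

text \<open>The Hessian of the same pair potential at \<open>d\<close>, as a linear map in
  \<open>h\<close>: the part along \<open>d\<close> comes from differentiating the scalar
  coefficient of \<open>pair_force\<close>, the multiple of \<open>h\<close> from differentiating
  its vector factor.\<close>

definition pair_hessian :: "'a::real_inner \<Rightarrow> 'a \<Rightarrow> 'a"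
  where "pair_hessian d h =
    (3 / norm d ^ 5 + 15 / norm d ^ 7) *\<^sub>R (d \<bullet> h) *\<^sub>R d
    - (1 / norm d ^ 3 + 3 / norm d ^ 5) *\<^sub>R h"

lemma pair_force_minus: "pair_force (- d) = - pair_force d"
  by (simp add: pair_force_def)

text \<open>Chain rule through the norm, whose gradient is \<open>sgn d\<close>. Writing
  \<open>sgn d\<close> as \<open>d\<close> divided by its norm raises the exponent from
  \<open>n + 1\<close> to \<open>n + 2\<close>.\<close>

lemma has_derivative_norm_power_inverse:
  fixes d :: "'a::real_inner"
  assumes "d \<noteq> 0"
  shows "((\<lambda>x. 1 / norm x ^ n) has_derivative
    (\<lambda>h. - (real n / norm d ^ (n + 2)) * (d \<bullet> h))) (at d)"
proof -
  have nz: "norm d \<noteq> 0" using assms by simp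
  have "((\<lambda>r. 1 / r ^ n) has_real_derivative - (real n / norm d ^ (n + 1))) (at (norm d))"
  \<comment> \<open>The power rule produces the truncated exponent \<open>n - 1\<close>, which
    combines as expected only for positive \<open>n\<close>; for \<open>n = 0\<close> the function
    is constant.\<close>
  proof (cases n)
    case (Suc m)
    have "((\<lambda>r. inverse (r ^ n)) has_real_derivative
        - (inverse (norm d ^ n) * (real n * norm d ^ (n - 1)) * inverse (norm d ^ n))) (at (norm d))"
      using nz by (auto intro!: derivative_eq_intros)
    moreover have "inverse (norm d ^ n) * (real n * norm d ^ (n - 1)) * inverse (norm d ^ n)
        = real n / norm d ^ (n + 1)"
      using nz Suc by (simp add: divide_simps)
    ultimately show ?thesis by (simp add: inverse_eq_divide)
  qed simp
  from has_derivative_compose[OF has_derivative_norm[OF assms]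
      this[unfolded has_field_derivative_def]]
  have "((\<lambda>x. 1 / norm x ^ n) has_derivative
    (\<lambda>h. - (real n / norm d ^ (n + 1)) * (h \<bullet> sgn d))) (at d)" .
  moreover have "- (real n / norm d ^ (n + 1)) * (h \<bullet> sgn d) =
      - (real n / norm d ^ (n + 2)) * (d \<bullet> h)" for h
    using nz by (simp add: sgn_div_norm inner_commute[of h d] divide_simps)
  ultimately show ?thesis by simp
qed

lemma has_derivative_pair_potential:
  fixes d :: "'a::real_inner"
  assumes "d \<noteq> 0"
  shows "((\<lambda>x. 1 / norm x + 1 / norm x ^ 3) has_derivative (\<lambda>h. pair_force d \<bullet> h)) (at d)"
proof -
  have D1: "((\<lambda>x. 1 / norm x) has_derivative (\<lambda>h. - (1 / norm d ^ 3) * (d \<bullet> h))) (at d)"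
    using has_derivative_norm_power_inverse[OF assms, of 1] by (simp add: power3_eq_cube mult.assoc)
  have D3: "((\<lambda>x. 1 / norm x ^ 3) has_derivative
      (\<lambda>h. - (3 / norm d ^ 5) * (d \<bullet> h))) (at d)"
    using has_derivative_norm_power_inverse[OF assms, of 3] by simp
  have "- (1 / norm d ^ 3) * (d \<bullet> h) + - (3 / norm d ^ 5) * (d \<bullet> h) =
      pair_force d \<bullet> h" for h
    by (simp add: pair_force_def algebra_simps)
  then show ?thesis
    using has_derivative_add[OF D1 D3] by (simp only:)
qed

lemma has_derivative_pair_force:
  fixes d :: "'a::real_inner"
  assumes "d \<noteq> 0"
  shows "(pair_force has_derivative pair_hessian d) (at d)"
proof -
  \<comment> \<open>The coefficient is split into multiples of pure inverse powers, so that the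
    product rule and the derivative of inverse powers apply literally.\<close>
  have "((\<lambda>x. - (1 / norm x ^ 3 + 3 * (1 / norm x ^ 5)) *\<^sub>R x) has_derivative
     (\<lambda>h. - (1 / norm d ^ 3 + 3 * (1 / norm d ^ 5)) *\<^sub>R h
        + (- (- (real 3 / norm d ^ (3 + 2)) * (d \<bullet> h)
              + 3 * (- (real 5 / norm d ^ (5 + 2)) * (d \<bullet> h)))) *\<^sub>R d)) (at d)"
    by (intro has_derivative_scaleR has_derivative_minus has_derivative_add
        has_derivative_mult_right has_derivative_norm_power_inverse has_derivative_ident assms)
  moreover have "(\<lambda>h. - (1 / norm d ^ 3 + 3 * (1 / norm d ^ 5)) *\<^sub>R h
        + (- (- (real 3 / norm d ^ (3 + 2)) * (d \<bullet> h)
              + 3 * (- (real 5 / norm d ^ (5 + 2)) * (d \<bullet> h)))) *\<^sub>R d) = pair_hessian d"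
    by (simp add: pair_hessian_def algebra_simps fun_eq_iff)
  moreover have "(\<lambda>x::'a. - (1 / norm x ^ 3 + 3 * (1 / norm x ^ 5)) *\<^sub>R x) = pair_force"
    by (simp add: pair_force_def fun_eq_iff)
  ultimately show ?thesis by simp
qed

section \<open>Gradient and Hessian of the Schwarzschild potential\<close>

text \<open>Action equals reaction: by antisymmetry each unordered pair contributes one term for
  either particle. Regrouping by particle turns the derivative of a sum over pairs into the pairing
  with the total force on each particle.\<close>

lemma sum_less_antisym:
  fixes f :: "'n::{finite,linorder} \<Rightarrow> 'n \<Rightarrow> 'a::real_inner"
  assumes "\<And>i j. f j i = - f i j"
  shows "(\<Sum>(i, j) \<in> {(i, j). i < j}. f i j \<bullet> (h i - h j)) = (\<Sum>i\<in>UNIV. (\<Sum>j\<in>UNIV. f i j) \<bullet> h i)"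
proof -
  have diag: "f i i = 0" for i
  proof -
    have "2 *\<^sub>R f i i = 0"
      using assms[of i i] unfolding scaleR_2 eq_neg_iff_add_eq_0 .
    then show ?thesis by simp
  qed
  have "f i j \<bullet> (h i - h j) = f i j \<bullet> h i + f j i \<bullet> h j" for i j
  proof -
    have "f j i = - f i j" by (rule assms)
    then show ?thesis by (simp add: inner_diff_right)
  qed
  then have "(\<Sum>(i, j) \<in> {(i, j). i < j}. f i j \<bullet> (h i - h j)) =
      (\<Sum>(i, j) \<in> {(i, j). i < j}. f i j \<bullet> h i) + (\<Sum>(i, j) \<in> {(i, j). i < j}. f j i \<bullet> h j)"
    by (simp only: case_prod_unfold sum.distrib)
  \<comment> \<open>Swapping the indices moves the reaction terms to the pairs with
    \<open>j < i\<close>; the two halves then cover everything but the diagonal, where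
    \<open>f\<close> vanishes.\<close>
  also have "(\<Sum>(i, j) \<in> {(i, j). i < j}. f j i \<bullet> h j) = (\<Sum>(i, j) \<in> {(i, j). j < i}. f i j \<bullet> h i)"
    by (rule sum.reindex_bij_witness[of _ prod.swap prod.swap]) auto
  also have "(\<Sum>(i, j) \<in> {(i, j). i < j}. f i j \<bullet> h i) + \<dots> =
      (\<Sum>(i, j) \<in> {(i, j). i < j} \<union> {(i, j). j < i}. f i j \<bullet> h i)"
    by (rule sum.union_disjoint[symmetric]) (auto intro: finite_subset[OF subset_UNIV])
  also have "\<dots> = (\<Sum>(i, j) \<in> UNIV. f i j \<bullet> h i)"
    by (rule sum.mono_neutral_left) (auto simp: diag not_less intro: order.antisym)
  also have "\<dots> = (\<Sum>i\<in>UNIV. (\<Sum>j\<in>UNIV. f i j) \<bullet> h i)"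
    by (simp add: inner_sum_left sum.cartesian_product flip: UNIV_Times_UNIV)
  finally show ?thesis .
qed

text \<open>The terms with \<open>j = i\<close> below vanish: the junk value of \<open>1 / 0\<close>
  multiplies the zero vector.\<close>

definition force :: "'n::finite config \<Rightarrow> 'n config"
  where "force q = config_of (\<lambda>i. \<Sum>j\<in>UNIV. pair_force (particle q i - particle q j))"

definition force_deriv :: "'n::finite config \<Rightarrow> 'n config \<Rightarrow> 'n config"
  where "force_deriv q h = config_of (\<lambda>i. \<Sum>j\<in>UNIV.
    pair_hessian (particle q i - particle q j) (particle h i - particle h j))"

text \<open>Injectivity of \<open>particle q\<close> expresses that no two particles collide. Every
  pair term is then differentiable by the chain rule, and \<open>sum_less_antisym\<close> collects
  the results by particle.\<close>

lemma gderiv_schwarzschild: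
  assumes "inj (particle q)"
  shows "GDERIV schwarzschild q :> force q"
proof -
  have "(schwarzschild has_derivative (\<lambda>h. \<Sum>(i, j) \<in> {(i, j). i < j}.
      pair_force (particle q i - particle q j) \<bullet> (particle h i - particle h j))) (at q)"
    unfolding schwarzschild_def split_beta
  proof (rule has_derivative_sum)
    fix p :: "'a \<times> 'a"
    assume "p \<in> {p. fst p < snd p}"
    then have nz: "particle q (fst p) - particle q (snd p) \<noteq> 0"
      using injD[OF assms, of "fst p" "snd p"] by auto
    have "((\<lambda>q. particle q (fst p) - particle q (snd p)) has_derivative
        (\<lambda>h. particle h (fst p) - particle h (snd p))) (at q)"
      by (intro has_derivative_diff bounded_linear_imp_has_derivative bounded_linear_particle)
    from has_derivative_compose[OF this has_derivative_pair_potential[OF nz]]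
    show "((\<lambda>q. 1 / norm (particle q (fst p) - particle q (snd p))
         + 1 / norm (particle q (fst p) - particle q (snd p)) ^ 3) has_derivative
       (\<lambda>h. pair_force (particle q (fst p) - particle q (snd p))
          \<bullet> (particle h (fst p) - particle h (snd p)))) (at q)" .
  qed
  moreover have "(\<Sum>(i, j) \<in> {(i, j). i < j}.
      pair_force (particle q i - particle q j) \<bullet> (particle h i - particle h j)) = force q \<bullet> h" for h
    unfolding force_def inner_config_of
    by (rule sum_less_antisym) (simp flip: pair_force_minus)
  ultimately show ?thesis
    unfolding gderiv_def inner_commute[of _ "force q"] by simp
qed

text \<open>Uniqueness of the Frechet derivative. This links the relation \<open>GDERIV\<close> to
  the total function \<open>gradient\<close>, and also shows that two gradients of \<open>f\<close>
  at one point agree.\<close>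

lemma gradient_eq:
  assumes "GDERIV f x :> D"
  shows "gradient f x = D"
proof -
  have "frechet_derivative f (at x) = (\<lambda>h. h \<bullet> D)"
    using assms frechet_derivative_at[of f _ x] unfolding gderiv_def by metis
  then show ?thesis
    by (simp add: gradient_def vec_eq_iff inner_axis')
qed

text \<open>Being free of collisions is an open condition. The Hessian differentiates the gradient,
  so the formula for the gradient has to hold on a whole neighbourhood.\<close>

lemma eventually_inj_particle:
  fixes z :: "'n::finite config"
  assumes "inj (particle z)"
  shows "\<forall>\<^sub>F q in nhds z. inj (particle q)"
proof -
  have "\<forall>\<^sub>F q in nhds z. \<forall>i j. i \<noteq> j \<longrightarrow> particle q i - particle q j \<noteq> 0"
  proof (intro eventually_all_finite)
    fix i j :: 'n
    have "((\<lambda>q. particle q i - particle q j) \<longlongrightarrow> particle z i - particle z j) (nhds z)"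
      by (intro tendsto_diff bounded_linear.tendsto[OF bounded_linear_particle] filterlim_ident)
    from tendsto_imp_eventually_ne[OF this, of 0]
    show "\<forall>\<^sub>F q in nhds z. i \<noteq> j \<longrightarrow> particle q i - particle q j \<noteq> 0"
      using injD[OF assms, of i j] by (cases "i = j") auto
  qed
  then show ?thesis
    by eventually_elim (auto simp: inj_def)
qed

lemma has_derivative_force:
  assumes "inj (particle z)"
  shows "(force has_derivative force_deriv z) (at z)"
proof -
  have pair: "((\<lambda>q. pair_force (particle q i - particle q j)) has_derivative
      (\<lambda>h. pair_hessian (particle z i - particle z j) (particle h i - particle h j))) (at z)" for i j
  proof (cases "i = j")
    \<comment> \<open>On the diagonal the function is constantly 0, and so is the claimed
      derivative.\<close>
    case True
    then show ?thesis by (simp add: pair_force_def pair_hessian_def)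
  next
    case False
    then have nz: "particle z i - particle z j \<noteq> 0"
      using injD[OF assms, of i j] by auto
    have "((\<lambda>q. particle q i - particle q j) has_derivative
        (\<lambda>h. particle h i - particle h j)) (at z)"
      by (intro has_derivative_diff bounded_linear_imp_has_derivative bounded_linear_particle)
    from has_derivative_compose[OF this has_derivative_pair_force[OF nz]] show ?thesis .
  qed
  have "bounded_linear (\<lambda>v::real^2. v $ k)" for k
    by (rule bounded_linear_vec_nth)
  then have "((\<lambda>q. (\<Sum>j\<in>UNIV. pair_force (particle q i - particle q j)) $ k) has_derivative
      (\<lambda>h. (\<Sum>j\<in>UNIV. pair_hessian (particle z i - particle z j) (particle h i - particle h j)) $ k))
      (at z)" for i k
    by (rule bounded_linear.has_derivative) (intro has_derivative_sum pair)
  then show ?thesis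
    unfolding force_def[abs_def] force_deriv_def[abs_def]
    by (subst has_derivative_componentwise_within)
      (auto simp: Basis_vec_def inner_axis config_of_def)
qed

text \<open>Near \<open>z\<close> the gradient coincides with \<open>force\<close>, so it inherits
  the derivative \<open>force_deriv z\<close>; the Jacobian is the matrix of that linear
  map.\<close>

lemma hessian_schwarzschild_mult:
  assumes "inj (particle z)"
  shows "hessian schwarzschild z *v h = force_deriv z h"
proof -
  have "\<forall>\<^sub>F q in nhds z. force q = gradient schwarzschild q"
    using eventually_inj_particle[OF assms]
    by eventually_elim (rule gradient_eq[OF gderiv_schwarzschild, symmetric])
  then have "\<forall>\<^sub>F q in at z. force q = gradient schwarzschild q"
    and "force z = gradient schwarzschild z"
    by (auto simp: eventually_at_filter elim: eventually_mono dest: eventually_nhds_x_imp_x)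
  then have D: "(gradient schwarzschild has_derivative force_deriv z) (at z)"
    using has_derivative_transform_eventually[OF has_derivative_force[OF assms]] by simp
  then have "frechet_derivative (gradient schwarzschild) (at z) = force_deriv z"
    by (metis frechet_derivative_at)
  then show ?thesis
    using fun_cong[OF matrix_vector_mul(2)[OF has_derivative_linear[OF D]], of h]
    by (simp add: hessian_def jacobian_def)
qed

section \<open>Uniform rotations and relative equilibria\<close>

text \<open>This is \<open>exp(-s J) = cos s - sin s J\<close>. It writes the motion as a
  combination of two fixed configurations, so only scalar functions of time have to be
  differentiated.\<close>

lemma rotating_eq:
  "rotating z \<omega> t =
    cos (\<omega> * t) *\<^sub>R z - sin (\<omega> * t) *\<^sub>R config_of (\<lambda>i. J *v particle z i)"
  unfolding vec_eq_iff split_paired_All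
  by (simp add: rotating_def config_of_def particle_def rotation_matrix_def J_def
      matrix_vector_mult_def sum_2 forall_2)

lemma rotating_velocity:
  "(rotating z \<omega> has_vector_derivative
    - (\<omega> * sin (\<omega> * t)) *\<^sub>R z
    - (\<omega> * cos (\<omega> * t)) *\<^sub>R config_of (\<lambda>i. J *v particle z i)) (at t)"
  unfolding rotating_eq[abs_def]
  by (auto intro!: derivative_eq_intros simp: algebra_simps)

lemma rotating_acceleration:
  "((\<lambda>t. - (\<omega> * sin (\<omega> * t)) *\<^sub>R z
    - (\<omega> * cos (\<omega> * t)) *\<^sub>R config_of (\<lambda>i. J *v particle z i))
    has_vector_derivative - \<omega>\<^sup>2 *\<^sub>R rotating z \<omega> t) (at t)"
  unfolding rotating_eq
  by (auto intro!: derivative_eq_intros simp: algebra_simps power2_eq_square)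

text \<open>Vector derivatives are unique, so the velocity and acceleration quantified in
  \<open>solves_newton\<close> must be the explicit ones. Only the equation for the gradient
  remains.\<close>

lemma relative_equilibrium_iff:
  "relative_equilibrium U z \<omega> \<longleftrightarrow>
    \<omega> > 0 \<and> (\<forall>t. GDERIV U (rotating z \<omega> t) :> - \<omega>\<^sup>2 *\<^sub>R rotating z \<omega> t)"
proof -
  define V where "V = (\<lambda>t. - (\<omega> * sin (\<omega> * t)) *\<^sub>R z
    - (\<omega> * cos (\<omega> * t)) *\<^sub>R config_of (\<lambda>i. J *v particle z i))"
  define A where "A = (\<lambda>t. - \<omega>\<^sup>2 *\<^sub>R rotating z \<omega> t)"
  have V: "(rotating z \<omega> has_vector_derivative V t) (at t)" for t
    unfolding V_def by (rule rotating_velocity)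
  have A: "(V has_vector_derivative A t) (at t)" for t
    unfolding V_def A_def by (rule rotating_acceleration)
  have "solves_newton U (rotating z \<omega>) \<longleftrightarrow> (\<forall>t. GDERIV U (rotating z \<omega> t) :> A t)"
  proof
    assume "solves_newton U (rotating z \<omega>)"
    then obtain v a where v: "\<And>t. (rotating z \<omega> has_vector_derivative v t) (at t)"
      and a: "\<And>t. (v has_vector_derivative a t) (at t)"
      and U: "\<And>t. GDERIV U (rotating z \<omega> t) :> a t"
      unfolding solves_newton_def by blast
    have "v = V"
      by (rule ext) (rule vector_derivative_unique_at[OF v V])
    with a have a: "(V has_vector_derivative a t) (at t)" for t
      by simp
    have "a = A"
      by (rule ext) (rule vector_derivative_unique_at[OF a A])
    then show "\<forall>t. GDERIV U (rotating z \<omega> t) :> A t"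
      using U by simp
  next
    assume "\<forall>t. GDERIV U (rotating z \<omega> t) :> A t"
    then show "solves_newton U (rotating z \<omega>)"
      unfolding solves_newton_def by (intro exI[of _ V] exI[of _ A]) (simp add: V A)
  qed
  then show ?thesis
    unfolding relative_equilibrium_def A_def by simp
qed

lemma norm_rotation [simp]: "norm (rotation_matrix s *v x) = norm x"
proof -
  have "(norm (rotation_matrix s *v x))\<^sup>2 =
      (cos s * x $ 1 - sin s * x $ 2)\<^sup>2 + (sin s * x $ 1 + cos s * x $ 2)\<^sup>2"
    unfolding power2_norm_eq_inner
    by (simp add: rotation_matrix_def matrix_vector_mult_def inner_vec_def sum_2 power2_eq_square)
  also have "\<dots> = ((sin s)\<^sup>2 + (cos s)\<^sup>2) * ((x $ 1)\<^sup>2 + (x $ 2)\<^sup>2)"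
    by algebra
  also have "\<dots> = (norm x)\<^sup>2"
    unfolding power2_norm_eq_inner sin_cos_squared_add
    by (simp add: inner_vec_def sum_2 power2_eq_square)
  finally show ?thesis by simp
qed

section \<open>The equilateral triangle as a relative equilibrium\<close>

lemma sqrt3_power:
  "sqrt 3 ^ 3 = 3 * sqrt 3" "sqrt 3 ^ 5 = 9 * sqrt 3" "sqrt 3 ^ 7 = 27 * sqrt 3"
  by (simp_all add: eval_nat_numeral)

text \<open>Side \<open>sqrt 3\<close> belongs to circumradius 1. Both conditions are invariant
  under rotation, so a single computation of the force serves the entire orbit.\<close>

definition equilateral :: "3 config \<Rightarrow> bool"
  where "equilateral q \<longleftrightarrow> (\<forall>i j. i \<noteq> j \<longrightarrow> norm (particle q i - particle q j) = sqrt 3)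
    \<and> (\<Sum>i\<in>UNIV. particle q i) = 0"

lemma equilateral_inj: "equilateral q \<Longrightarrow> inj (particle q)"
  by (force simp: equilateral_def inj_def)

text \<open>At distance \<open>sqrt 3\<close> the coefficient of the pair force is
  \<open>1 / (3 * sqrt 3) + 3 / (9 * sqrt 3) = 2 / (3 * sqrt 3)\<close>. Since the centroid is the
  origin, the differences from particle \<open>i\<close> add up to three times its position.\<close>

lemma force_equilateral:
  assumes "equilateral q"
  shows "force q = - (2 / sqrt 3) *\<^sub>R q"
proof -
  have "pair_force (particle q i - particle q j) =
      - (2 / (3 * sqrt 3)) *\<^sub>R (particle q i - particle q j)" for i j
    using assms by (cases "i = j") (auto simp: equilateral_def pair_force_def sqrt3_power)
  then have "(\<Sum>j\<in>UNIV. pair_force (particle q i - particle q j)) =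
      - (2 / (3 * sqrt 3)) *\<^sub>R (\<Sum>j\<in>UNIV. particle q i - particle q j)" for i
    by (simp add: scaleR_sum_right)
  moreover have "(\<Sum>j\<in>UNIV. particle q i - particle q j) = 3 *\<^sub>R particle q i" for i
    using assms by (simp add: sum_subtractf equilateral_def scaleR_conv_of_real sum_constant_scaleR)
  ultimately show ?thesis
    by (simp add: force_def vec_eq_iff config_of_def particle_def)
qed

lemma particle_triangle:
  "particle equilateral_triangle 1 = vector [1, 0]"
  "particle equilateral_triangle 2 = vector [-1/2, sqrt 3 / 2]"
  "particle equilateral_triangle 3 = vector [-1/2, - sqrt 3 / 2]"
  by (simp_all add: equilateral_triangle_def)

lemma equilateral_triangle: "equilateral equilateral_triangle"
  unfolding equilateral_def forall_3 particle_triangle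
  by (simp add: particle_triangle sum_3 vec_eq_iff forall_2 norm_eq_sqrt_inner inner_vec_def sum_2
      power2_eq_square field_simps)

lemma equilateral_rotating:
  assumes "equilateral z"
  shows "equilateral (rotating z \<omega> t)"
  using assms
  by (simp add: equilateral_def rotating_def flip: matrix_vector_mult_diff_distrib vec.sum)

lemma relative_equilibrium_triangle:
  assumes "\<omega> > 0"
  shows "relative_equilibrium schwarzschild equilateral_triangle \<omega> \<longleftrightarrow> \<omega>\<^sup>2 = 2 / sqrt 3"
proof -
  let ?q = "rotating equilateral_triangle \<omega>"
  have eq: "equilateral (?q t)" for t
    by (intro equilateral_rotating equilateral_triangle)
  have D: "GDERIV schwarzschild (?q t) :> - (2 / sqrt 3) *\<^sub>R ?q t" for t
    unfolding force_equilateral[OF eq, symmetric]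
    by (rule gderiv_schwarzschild[OF equilateral_inj[OF eq]])
  \<comment> \<open>Comparing the scalars in front of \<open>?q t\<close> requires a nonzero
    configuration; at the zero configuration particles 1 and 2 would coincide.\<close>
  have nz: "?q t \<noteq> 0" for t
  proof
    assume "?q t = 0"
    then show False
      using injD[OF equilateral_inj[OF eq[of t]], of 1 2] by (simp add: particle_def)
  qed
  show ?thesis
    unfolding relative_equilibrium_iff
  proof (intro iffI conjI allI assms)
    assume "\<omega> > 0 \<and> (\<forall>t. GDERIV schwarzschild (?q t) :> - \<omega>\<^sup>2 *\<^sub>R ?q t)"
    then have "GDERIV schwarzschild (?q 0) :> - \<omega>\<^sup>2 *\<^sub>R ?q 0" by blast
    then have "- \<omega>\<^sup>2 *\<^sub>R ?q 0 = - (2 / sqrt 3) *\<^sub>R ?q 0"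
      by (rule trans[OF gradient_eq[symmetric] gradient_eq[OF D]])
    then have "- \<omega>\<^sup>2 = - (2 / sqrt 3)"
      using nz[of 0] unfolding scaleR_cancel_right by blast
    then show "\<omega>\<^sup>2 = 2 / sqrt 3" by simp
  next
    fix t
    assume "\<omega>\<^sup>2 = 2 / sqrt 3"
    then show "GDERIV schwarzschild (?q t) :> - \<omega>\<^sup>2 *\<^sub>R ?q t"
      by (simp only: D)
  qed
qed

section \<open>Eigenvalues of the linearization from a quadratic equation\<close>

text \<open>The block matrix is the companion form of a quadratic eigenvalue problem, with
  eigenvector \<open>(X, \<mu> X)\<close>: the first block row holds by construction, the second is
  the quadratic equation.\<close>

lemma complex_eigenvalue_block:
  fixes C D :: "real ^ 'm::finite ^ 'm" and X :: "complex ^ 'm"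
  assumes "X \<noteq> 0"
    and "\<mu>\<^sup>2 *s X =
      map_matrix complex_of_real C *v X + \<mu> *s (map_matrix complex_of_real D *v X)"
  shows "complex_eigenvalue (block_matrix 0 (mat 1) C D) \<mu>"
proof -
  define v :: "complex ^ ('m + 'm)"
    where "v = (\<chi> r. case r of Inl i \<Rightarrow> X $ i | Inr i \<Rightarrow> \<mu> * X $ i)"
  have UN: "(\<Sum>r\<in>UNIV. f r) = (\<Sum>i\<in>UNIV. f (Inl i)) + (\<Sum>i\<in>UNIV. f (Inr i))"
    for f :: "'m + 'm \<Rightarrow> complex"
    by (simp add: sum.Plus flip: UNIV_Plus_UNIV)
  obtain i where "X $ i \<noteq> 0" using assms(1) by (auto simp: vec_eq_iff)
  then have "v $ Inl i \<noteq> 0" by (simp add: v_def)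
  then have "v \<noteq> 0" by auto
  moreover have "(map_matrix complex_of_real (block_matrix 0 (mat 1) C D) *v v) $ r
      = (\<mu> *s v) $ r" for r
  proof (cases r)
    case (Inl i)
    then show ?thesis
      by (simp add: matrix_vector_mult_def map_matrix_def block_matrix_def v_def UN mat_def
          if_distrib[of complex_of_real] if_distrib[of "\<lambda>x. x * _"] cong: if_cong)
  next
    case (Inr i)
    have "(\<mu>\<^sup>2 *s X) $ i =
      (map_matrix complex_of_real C *v X + \<mu> *s (map_matrix complex_of_real D *v X)) $ i"
      using assms(2) by simp
    then show ?thesis
      using Inr by (simp add: matrix_vector_mult_def map_matrix_def block_matrix_def v_def UN
          sum_distrib_left power2_eq_square mult_ac)
  qed
  ultimately show ?thesis
    unfolding complex_eigenvalue_def vec_eq_iff[of "_ *v _"] by blast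
qed

section \<open>The unstable mode\<close>

text \<open>The real and imaginary parts of \<open>X\<^sub>j = \<zeta>\<^sup>-\<^sup>j (1, -\<i>)\<close>.\<close>

definition mode_re :: "3 config"
  where "mode_re = config_of (($) (vector
    [vector [1, 0], vector [-1/2, - sqrt 3 / 2], vector [-1/2, sqrt 3 / 2]] :: real ^ 2 ^ 3))"

definition mode_im :: "3 config"
  where "mode_im = config_of (\<lambda>i. J *v particle mode_re i)"

lemma particle_mode:
  "particle mode_re 1 = vector [1, 0]"
  "particle mode_re 2 = vector [-1/2, - sqrt 3 / 2]"
  "particle mode_re 3 = vector [-1/2, sqrt 3 / 2]"
  "particle mode_im 1 = vector [0, -1]"
  "particle mode_im 2 = vector [- sqrt 3 / 2, 1/2]"
  "particle mode_im 3 = vector [sqrt 3 / 2, 1/2]"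
  by (simp_all add: mode_re_def mode_im_def J_def matrix_vector_mult_def sum_2 vec_eq_iff forall_2)

lemma pair_hessian_sqrt3:
  assumes "norm d = sqrt 3"
  shows "pair_hessian d h = (2 / (9 * sqrt 3)) *\<^sub>R ((4 * (d \<bullet> h)) *\<^sub>R d - 3 *\<^sub>R h)"
  by (simp add: pair_hessian_def assms sqrt3_power algebra_simps)

text \<open>Identify the plane with the complex numbers and let d and k be the differences of
  positions and of perturbations for a pair. As |d|^2 = 3, the bracket
  \<open>4 (d . k) d - 3 k\<close> equals 2 d^2 conj(k) + 3 k. For both modes conj(k) is a constant
  multiple of d, and the cubes of the differences from one vertex sum to 0. The terms 3 k sum to 9
  times the perturbation of that particle, because the modes have centroid 0.\<close>

lemma force_deriv_triangle:
  assumes "h = mode_re \<or> h = mode_im"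
  shows "force_deriv equilateral_triangle h = (2 / sqrt 3) *\<^sub>R h"
proof -
  let ?p = "particle equilateral_triangle"
  have pair: "pair_hessian (?p i - ?p j) (particle h i - particle h j) =
      (2 / (9 * sqrt 3)) *\<^sub>R ((4 * ((?p i - ?p j) \<bullet> (particle h i - particle h j))) *\<^sub>R (?p i - ?p j)
        - 3 *\<^sub>R (particle h i - particle h j))" for i j
  proof (cases "i = j")
    case False
    then show ?thesis
      using equilateral_triangle by (intro pair_hessian_sqrt3) (simp add: equilateral_def)
  qed (simp add: pair_hessian_def)
  have "(\<Sum>j\<in>UNIV. (4 * ((?p i - ?p j) \<bullet> (particle h i - particle h j))) *\<^sub>R (?p i - ?p j)
        - 3 *\<^sub>R (particle h i - particle h j)) = 9 *\<^sub>R particle h i" for i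
  proof -
    have "\<forall>i. (\<Sum>j\<in>UNIV. (4 * ((?p i - ?p j) \<bullet> (particle h i - particle h j))) *\<^sub>R (?p i - ?p j)
        - 3 *\<^sub>R (particle h i - particle h j)) = 9 *\<^sub>R particle h i"
      using assms unfolding forall_3
      by (elim disjE; hypsubst) (simp_all add: particle_triangle particle_mode sum_3 vec_eq_iff forall_2
          inner_vec_def sum_2 algebra_simps)
    then show ?thesis by blast
  qed
  then have "(\<Sum>j\<in>UNIV. pair_hessian (?p i - ?p j) (particle h i - particle h j)) =
      (2 / sqrt 3) *\<^sub>R particle h i" for i
    unfolding pair scaleR_sum_right[symmetric] by simp
  then show ?thesis
    by (simp add: force_deriv_def vec_eq_iff config_of_def particle_def)
qed

text \<open>A real matrix acts separately on real and imaginary parts, which reduces the complex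
  equation to the two real modes.\<close>

lemma map_matrix_complex_mult:
  fixes M :: "real ^ 'm::finite ^ 'm"
  shows "map_matrix complex_of_real M *v (\<chi> p. Complex (a $ p) (b $ p)) =
    (\<chi> p. Complex ((M *v a) $ p) ((M *v b) $ p))"
  by (simp add: vec_eq_iff complex_eq_iff matrix_vector_mult_def map_matrix_def Re_sum Im_sum)

lemma block_J_mult: "block_J *v h = config_of (\<lambda>i. J *v particle h i)"
proof -
  have "(block_J *v h) $ (i, k) = config_of (\<lambda>i. J *v particle h i) $ (i, k)" for i k
  proof -
    have "(block_J *v h) $ (i, k) =
        (\<Sum>j\<in>UNIV. \<Sum>l\<in>UNIV. (if i = j then J $ k $ l else 0) * h $ (j, l))"
      unfolding sum.cartesian_product
      by (simp add: block_J_def matrix_vector_mult_def split_beta cong: if_cong)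
    also have "\<dots> = (\<Sum>j\<in>UNIV. if i = j then \<Sum>l\<in>UNIV. J $ k $ l * h $ (j, l) else 0)"
      by (rule sum.cong) auto
    also have "\<dots> = config_of (\<lambda>i. J *v particle h i) $ (i, k)"
      by (simp add: config_of_def particle_def matrix_vector_mult_def)
    finally show ?thesis .
  qed
  then show ?thesis by (simp add: vec_eq_iff split_paired_All)
qed

text \<open>Together these say that \<open>mode_re + i mode_im\<close> is an eigenvector of
  \<open>block_J\<close> for the eigenvalue \<open>-i\<close>.\<close>

lemma block_J_mode: "block_J *v mode_re = mode_im" "block_J *v mode_im = - mode_re"
proof -
  show "block_J *v mode_re = mode_im"
    by (simp add: block_J_mult mode_im_def)
  have "J *v (J *v x) = - x" for x
    by (simp add: J_def matrix_vector_mult_def sum_2 vec_eq_iff forall_2)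
  then show "block_J *v mode_im = - mode_re"
    by (simp add: block_J_mult mode_im_def vec_eq_iff config_of_def particle_def)
qed

lemma linearly_unstable_triangle:
  assumes "\<omega> > 0" and "\<omega>\<^sup>2 = 2 / sqrt 3"
  shows "linearly_unstable schwarzschild equilateral_triangle \<omega>"
proof -
  let ?C = "\<omega>\<^sup>2 *\<^sub>R mat 1 + hessian schwarzschild equilateral_triangle"
  let ?D = "(2 * \<omega>) *\<^sub>R (block_J :: real ^ (3 \<times> 2) ^ (3 \<times> 2))"
  define X :: "complex ^ (3 \<times> 2)" where "X = (\<chi> p. Complex (mode_re $ p) (mode_im $ p))"
  \<comment> \<open>The other root of the quadratic is \<open>- \<omega> (1 + i)\<close>; this one
    has real part \<omega>.\<close>
  define \<mu> where "\<mu> = Complex \<omega> (- \<omega>)"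
  have "particle mode_re 1 $ 1 = 1"
    by (simp add: particle_mode)
  then have "X $ (1, 1) \<noteq> 0"
    by (simp add: X_def particle_def complex_eq_iff)
  then have X: "X \<noteq> 0" by auto
  \<comment> \<open>The centrifugal term and the Hessian contribute \<omega> squared each, the
    latter because \<open>2 / sqrt 3\<close> is that square.\<close>
  have C: "?C *v h = (2 * \<omega>\<^sup>2) *\<^sub>R h" if "h = mode_re \<or> h = mode_im" for h
    using force_deriv_triangle[OF that] assms(2)
    by (simp add: matrix_vector_mult_add_rdistrib scaleR_matrix_vector_assoc[symmetric]
        hessian_schwarzschild_mult[OF equilateral_inj[OF equilateral_triangle]] flip: scaleR_2)
  have D: "?D *v mode_re = (2 * \<omega>) *\<^sub>R mode_im" "?D *v mode_im = (2 * \<omega>) *\<^sub>R (- mode_re)"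
    by (simp_all add: scaleR_matrix_vector_assoc[symmetric] block_J_mode)
  \<comment> \<open>Both sides are \<open>-2 i \<omega>\<^sup>2\<close> times
    \<open>X\<close>.\<close>
  have "\<mu>\<^sup>2 *s X =
      map_matrix complex_of_real ?C *v X + \<mu> *s (map_matrix complex_of_real ?D *v X)"
    unfolding X_def map_matrix_complex_mult D C[OF disjI1[OF refl]] C[OF disjI2[OF refl]]
    by (simp add: vec_eq_iff complex_eq_iff \<mu>_def power2_eq_square algebra_simps)
  then have "complex_eigenvalue (linearization schwarzschild equilateral_triangle \<omega>) \<mu>"
    unfolding linearization_def by (rule complex_eigenvalue_block[OF X])
  moreover have "Re \<mu> > 0" using assms(1) by (simp add: \<mu>_def)
  ultimately show ?thesis
    unfolding linearly_unstable_def by blast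
qed

theorem mainTheorem4:
  fixes \<omega> :: real
  assumes "\<omega> > 0"
  shows "(relative_equilibrium schwarzschild equilateral_triangle \<omega> \<longleftrightarrow> \<omega>\<^sup>2 = 2 / sqrt 3)
       \<and> (relative_equilibrium schwarzschild equilateral_triangle \<omega>
            \<longrightarrow> linearly_unstable schwarzschild equilateral_triangle \<omega>)"
  using relative_equilibrium_triangle[OF assms] linearly_unstable_triangle[OF assms] by blast

end
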